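(* Let $n\ge 5$ be an odd integer and let $t\ge 1$ be an integer. Then every Open Star $S(t, G_n)$ of $t$ copies of the Goldberg Snark graph $G_n$ is a Cordial graph.
   Context: **Goldberg Snark $G_n$.** For an odd integer $n\ge 5$, $G_n$ is the simple undirected cubic graph with the $8n$ vertices $v_{i,j}$ ($1\le i\le n$, $1\le j\le 8$) and the following $12n$ edges, where the first index is read cyclically modulo $n$ (so $v_{n+1,j}=v_{1,j}$). For every $1\le i\le n$: - inside the $i$-th block: $v_{i,1}v_{i,3}$, $v_{i,2}v_{i,4}$, $v_{i,3}v_{i,5}$, $v_{i,5}v_{i,7}$, $v_{i,1}v_{i,6}$, $v_{i,3}v_{i,8}$, $v_{i,1}v_{i,2}$, $v_{i,4}v_{i,5}$, $v_{i,6}v_{i,7}$; - between consecutive blocks: $v_{i,8}v_{i+1,8}$, $v_{i,6}v_{i+1,7}$, $v_{i,4}v_{i+1,2}$. **Open Star.** An Open Star $S(t,G)$ of a graph $G$ is a graph obtained from the star $K_{1,t}$ by replacing each vertex other than the apex (central) vertex $v_0$ by a copy of $G$. That is, it consists of the vertex $v_0$, $t$ disjoint copies of $G$, and, for each copy, exactly one edge joining $v_0$ to a vertex of that copy. (So it has $t|V(G)|+1$ vertices and $t|E(G)|+t$ edges.) **Cordial graph.** Let $G=(V,E)$ be a finite simple graph. A vertex labeling $f:V(G)\to\{0,1\}$ induces the edge labeling $f^*:E(G)\to\{0,1\}$, $f^*(uv)=|f(u)-f(v)|$. For $i\in\{0,1\}$ let $v_f(i)$ be the number of vertices $v$ with $f(v)=i$,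 and $e_f(i)$ the number of edges $e$ with $f^*(e)=i$. Then $f$ is a Cordial labeling of $G$ if $|v_f(0)-v_f(1)|\le 1$ and $|e_f(0)-e_f(1)|\le 1$. A graph is Cordial if it admits a Cordial labeling. *)

theory Defs
  imports Main
begin

type_synonym 'a ugraph = "'a set \<times> 'a set set"

abbreviation verts :: "'a ugraph \<Rightarrow> 'a set" where "verts \<equiv> fst"
abbreviation edges :: "'a ugraph \<Rightarrow> 'a set set" where "edges \<equiv> snd"

definition finite_simple_graph :: "'a ugraph \<Rightarrow> bool" where
  "finite_simple_graph G \<longleftrightarrow>
     finite (verts G) \<and>
     edges G \<subseteq> {{u, v} | u v. u \<in> verts G \<and> v \<in> verts G \<and> u \<noteq> v}"

definition map_graph :: "('a \<Rightarrow> 'b) \<Rightarrow> 'a ugraph \<Rightarrow> 'b ugraph" where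
  "map_graph h G = (h ` verts G, (\<lambda>e. h ` e) ` edges G)"


definition goldberg_block :: "(nat \<times> nat) set" where
  "goldberg_block = {(1,3), (2,4), (3,5), (5,7), (1,6), (3,8), (1,2), (4,5), (6,7)}"

definition goldberg_link :: "(nat \<times> nat) set" where
  "goldberg_link = {(8,8), (6,7), (4,2)}"

text \<open>The pair \<open>(i, j)\<close> is the vertex \<open>v\<^sub>i\<^sub>,\<^sub>j\<close>.  For \<open>i\<close> in \<open>{1..n}\<close>, the cyclic successor
  of \<open>i\<close> in \<open>{1..n}\<close> is \<open>i mod n + 1\<close>.\<close>

definition goldberg :: "nat \<Rightarrow> (nat \<times> nat) ugraph" where
  "goldberg n =
     ({1..n} \<times> {1..8},
      {{(i, j), (i, k)} | i j k. i \<in> {1..n} \<and> (j, k) \<in> goldberg_block} \<union>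
      {{(i, j), (i mod n + 1, k)} | i j k. i \<in> {1..n} \<and> (j, k) \<in> goldberg_link})"


text \<open>\<open>open_star t G H\<close>: the graph \<open>H\<close> is an open star of \<open>t\<close> copies of \<open>G\<close>, with apex \<open>v0\<close>,
  \<open>i\<close>-th copy the image of \<open>G\<close> under the injection \<open>h i\<close>, and \<open>a i\<close> the vertex of that copy joined
  to the apex.  The attachment vertices may correspond to different vertices of \<open>G\<close> in different
  copies, so \<open>t\<close> and \<open>G\<close> do not determine \<open>H\<close> up to isomorphism.\<close>

definition open_star :: "nat \<Rightarrow> 'a ugraph \<Rightarrow> 'b ugraph \<Rightarrow> bool" where
  "open_star t G H \<longleftrightarrow>
     (\<exists>(v0 :: 'b) (h :: nat \<Rightarrow> 'a \<Rightarrow> 'b) (a :: nat \<Rightarrow> 'b).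
        (\<forall>i\<in>{1..t}. inj_on (h i) (verts G) \<and> v0 \<notin> h i ` verts G \<and> a i \<in> h i ` verts G) \<and>
        (\<forall>i\<in>{1..t}. \<forall>j\<in>{1..t}. i \<noteq> j \<longrightarrow> h i ` verts G \<inter> h j ` verts G = {}) \<and>
        verts H = {v0} \<union> (\<Union>i\<in>{1..t}. verts (map_graph (h i) G)) \<and>
        edges H = (\<Union>i\<in>{1..t}. edges (map_graph (h i) G)) \<union> {{v0, a i} | i. i \<in> {1..t}})"


definition vertex_count :: "'a ugraph \<Rightarrow> ('a \<Rightarrow> int) \<Rightarrow> int \<Rightarrow> nat" where
  "vertex_count G f i = card {v \<in> verts G. f v = i}"

definition edge_count :: "'a ugraph \<Rightarrow> ('a \<Rightarrow> int) \<Rightarrow> int \<Rightarrow> nat" where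
  "edge_count G f i = card {e \<in> edges G. \<exists>u v. e = {u, v} \<and> \<bar>f u - f v\<bar> = i}"

definition cordial_labeling :: "'a ugraph \<Rightarrow> ('a \<Rightarrow> int) \<Rightarrow> bool" where
  "cordial_labeling G f \<longleftrightarrow>
     f ` verts G \<subseteq> {0, 1} \<and>
     \<bar>int (vertex_count G f 0) - int (vertex_count G f 1)\<bar> \<le> 1 \<and>
     \<bar>int (edge_count G f 0) - int (edge_count G f 1)\<bar> \<le> 1"

definition cordial_graph :: "'a ugraph \<Rightarrow> bool" where
  "cordial_graph G \<longleftrightarrow> finite_simple_graph G \<and> (\<exists>f. cordial_labeling G f)"

end

theory Submission
  imports Defs
begin

text \<open>Label the vertices \<open>v\<^sub>i\<^sub>,\<^sub>1, v\<^sub>i\<^sub>,\<^sub>2, v\<^sub>i\<^sub>,\<^sub>3, v\<^sub>i\<^sub>,\<^sub>6\<close> of every block of the Goldberg snark by 1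
  and the others by 0.  This labeling is exactly balanced on vertices and on edges, and so is its
  complement.  In an open star, label the apex by 0 and use on each copy the labeling or its
  complement, chosen so that the labels of the edges at the apex alternate.\<close>

section \<open>Edge labels and balanced labelings\<close>

text \<open>Set-valued, so that it is well defined on unordered edges: on a doubleton it is a
  singleton, and \<open>b \<in> edge_labels f e\<close> then says that \<open>e\<close> has label
  \<open>b\<close>.\<close>

definition edge_labels :: "('a \<Rightarrow> int) \<Rightarrow> 'a set \<Rightarrow> int set" where
  "edge_labels f e = {\<bar>f u - f v\<bar> | u v. e = {u, v}}"

lemma edge_labels_doubleton [simp]: "edge_labels f {u, v} = {\<bar>f u - f v\<bar>}"
  by (auto simp: edge_labels_def doubleton_eq_iff)

lemma edge_count_eq: "edge_count G f b = card {e \<in> edges G. b \<in> edge_labels f e}"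
  unfolding edge_count_def edge_labels_def by (rule arg_cong[where f = card]) auto

lemma edge_labels_image:
  assumes "finite_simple_graph G" "e \<in> edges G" "\<And>x. x \<in> verts G \<Longrightarrow> F (h x) = g x"
  shows "edge_labels F (h ` e) = edge_labels g e"
proof -
  from assms(1,2) obtain u v where "e = {u, v}" "u \<in> verts G" "v \<in> verts G"
    unfolding finite_simple_graph_def by blast
  then show ?thesis using assms(3) by simp
qed

text \<open>Exact equality, where cordiality allows a defect of 1: defects of \<open>t\<close>
  copies could add up, and the apex and its edges use the allowance.\<close>

definition balanced_labeling :: "'a ugraph \<Rightarrow> ('a \<Rightarrow> int) \<Rightarrow> bool" where
  "balanced_labeling G f \<longleftrightarrow>
     f ` verts G \<subseteq> {0, 1} \<and>
     vertex_count G f 0 = vertex_count G f 1 \<and>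
     edge_count G f 0 = edge_count G f 1"

lemma vertex_count_complement: "vertex_count G (\<lambda>x. 1 - f x) b = vertex_count G f (1 - b)"
  unfolding vertex_count_def by (rule arg_cong[where f = card]) auto

text \<open>Complementing only reverses the sign of each difference, as
  \<open>(1 - f u) - (1 - f v) = f v - f u\<close>. The label of an attachment vertex can thus be
  flipped at no cost in edges.\<close>

lemma edge_count_complement: "edge_count G (\<lambda>x. 1 - f x) b = edge_count G f b"
  by (simp add: edge_count_def abs_minus_commute)

section \<open>Open stars of a graph with a balanced labeling\<close>

lemma card_parity_class_diff:
  "\<bar>int (card {i \<in> {1..t}. int (i mod 2) = 0}) - int (card {i \<in> {1..t}. int (i mod 2) = 1})\<bar> \<le> 1"
proof -
  let ?c = "\<lambda>t b. int (card {i \<in> {1..t}. int (i mod 2) = b})"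
  have step: "?c (Suc s) b = ?c s b + of_bool (int (Suc s mod 2) = b)" for s b
  proof -
    have "{i \<in> {1..Suc s}. int (i mod 2) = b} =
        (if int (Suc s mod 2) = b then insert (Suc s) {i \<in> {1..s}. int (i mod 2) = b}
         else {i \<in> {1..s}. int (i mod 2) = b})"
      by (auto simp: le_Suc_eq)
    then show ?thesis by simp
  qed
  \<comment> \<open>The bound alone is not inductive, the exact difference is. Since the indices
    start at the odd number 1, label 1 leads by \<open>t mod 2\<close>.\<close>
  have "?c t 1 - ?c t 0 = int (t mod 2)"
  proof (induction t)
    case (Suc t)
    then show ?case unfolding step
      by (cases "even t") (auto simp: mod_Suc even_iff_mod_2_eq_zero odd_iff_mod_2_eq_one)
  qed simp
  then show ?thesis by linarith
qed

text \<open>The copies contribute equally to both labels. The vertex counts therefore differ by 1,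
  from the apex, and the edge counts by \<open>t mod 2\<close>, from the alternating edges at the
  apex.\<close>

lemma cordial_open_star:
  fixes G :: "'a ugraph" and H :: "'b ugraph"
  assumes G: "finite_simple_graph G" and L: "balanced_labeling G L" and H: "open_star t G H"
  shows "cordial_graph H"
proof -
  define V where "V = verts G"
  from H obtain v0 :: 'b and h :: "nat \<Rightarrow> 'a \<Rightarrow> 'b" and a :: "nat \<Rightarrow> 'b" where
    copies: "\<forall>i\<in>{1..t}. inj_on (h i) V \<and> v0 \<notin> h i ` V \<and> a i \<in> h i ` V"
    and disjoint: "\<forall>i\<in>{1..t}. \<forall>j\<in>{1..t}. i \<noteq> j \<longrightarrow> h i ` V \<inter> h j ` V = {}"
    and vH: "verts H = {v0} \<union> (\<Union>i\<in>{1..t}. h i ` V)"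
    and eH: "edges H = (\<Union>i\<in>{1..t}. (\<lambda>e. h i ` e) ` edges G) \<union> {{v0, a i} | i. i \<in> {1..t}}"
    unfolding open_star_def map_graph_def V_def[symmetric] fst_conv snd_conv
    by (elim exE conjE) (rule that)
  have inj: "inj_on (h i) V" and v0: "v0 \<notin> h i ` V" and a: "a i \<in> h i ` V" if "i \<in> {1..t}" for i
    using copies that by simp_all
  have disj: "h i ` V \<inter> h j ` V = {}" if "i \<in> {1..t}" "j \<in> {1..t}" "i \<noteq> j" for i j
    using disjoint that by simp
  have finV: "finite V" and edge: "\<And>e. e \<in> edges G \<Longrightarrow> \<exists>u v. e = {u, v} \<and> u \<in> V \<and> v \<in> V \<and> u \<noteq> v"
    using G unfolding finite_simple_graph_def V_def by auto
  have eV: "e \<subseteq> V" if "e \<in> edges G" for e using edge[OF that] by auto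
  have finE: "finite (edges G)"
    using finV eV by (meson PowI finite_Pow_iff finite_subset subsetI)
  have L01: "L x = 0 \<or> L x = 1" if "x \<in> V" for x
    using L that unfolding balanced_labeling_def V_def by auto
  \<comment> \<open>The attachment vertex is pulled back to \<open>G\<close>, where \<open>L\<close>
    labels it.\<close>
  define p where "p i = (SOME x. x \<in> V \<and> h i x = a i)" for i
  have p: "p i \<in> V" "h i (p i) = a i" if "i \<in> {1..t}" for i
  proof -
    have "\<exists>x. x \<in> V \<and> h i x = a i" using a[OF that] by auto
    from someI_ex[OF this] show "p i \<in> V" "h i (p i) = a i" by (auto simp: p_def)
  qed
  \<comment> \<open>As the apex gets 0, the edge from it to copy \<open>i\<close> inherits the label
    of the attachment vertex; the choice makes this \<open>i mod 2\<close>.\<close>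
  define g where "g i = (if L (p i) = int (i mod 2) then L else (\<lambda>x. 1 - L x))" for i
  have g01: "g i x = 0 \<or> g i x = 1" if "x \<in> V" for i x
    using L01[OF that] by (auto simp: g_def)
  have gp: "g i (p i) = int (i mod 2)" if "i \<in> {1..t}" for i
    using L01[OF p(1)[OF that]] by (auto simp: g_def)
  have gv: "vertex_count G (g i) b = vertex_count G L 1" if "b \<in> {0, 1}" for i b
    using that L by (auto simp: g_def vertex_count_complement balanced_labeling_def)
  have ge: "edge_count G (g i) b = edge_count G L 1" if "b \<in> {0, 1}" for i b
    using that L by (auto simp: g_def edge_count_complement balanced_labeling_def)
  have injh: "inj_on (\<lambda>(i, x). h i x) ({1..t} \<times> V)"
  proof (rule inj_onI, clarify)
    fix i x j y assume A: "i \<in> {1..t}" "x \<in> V" "j \<in> {1..t}" "y \<in> V" "h i x = h j y"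
    then have "i = j" using disj[of i j] by blast
    then show "i = j \<and> x = y" using A inj[of i] by (auto dest: inj_onD)
  qed
  \<comment> \<open>By \<open>injh\<close> the pair \<open>(i, x)\<close> is unique for each vertex
    of a copy; outside \<open>H\<close> the value is arbitrary.\<close>
  define F where "F w = (if w = v0 then 0 else
      (case inv_into ({1..t} \<times> V) (\<lambda>(i, x). h i x) w of (i, x) \<Rightarrow> g i x))" for w
  have Fv0: "F v0 = 0" by (simp add: F_def)
  have Fh: "F (h i x) = g i x" if "i \<in> {1..t}" "x \<in> V" for i x
  proof -
    have "inv_into ({1..t} \<times> V) (\<lambda>(i, x). h i x) (h i x) = (i, x)"
      using inv_into_f_f[OF injh, of "(i, x)"] that by simp
    moreover have "h i x \<noteq> v0" using v0[OF that(1)] that(2) by auto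
    ultimately show ?thesis by (simp add: F_def)
  qed
  have Fa: "F (a i) = int (i mod 2)" if "i \<in> {1..t}" for i
    using Fh[OF that p(1)[OF that]] p(2)[OF that] gp[OF that] by simp
  have av0: "a i \<noteq> v0" if "i \<in> {1..t}" for i using a[OF that] v0[OF that] by auto
  have simple: "finite_simple_graph H"
    unfolding finite_simple_graph_def
  proof (intro conjI subsetI)
    show "finite (verts H)" using finV by (simp add: vH)
    fix e assume "e \<in> edges H"
    then consider i e' where "i \<in> {1..t}" "e' \<in> edges G" "e = h i ` e'"
      | i where "i \<in> {1..t}" "e = {v0, a i}" unfolding eH by blast
    then show "e \<in> {{u, v} | u v. u \<in> verts H \<and> v \<in> verts H \<and> u \<noteq> v}"
    proof cases
      case 1
      from edge[OF 1(2)] obtain u v where uv: "e' = {u, v}" "u \<in> V" "v \<in> V" "u \<noteq> v" by blast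
      then have "e = {h i u, h i v}" "h i u \<noteq> h i v"
        using 1 inj[OF 1(1)] by (auto dest: inj_onD)
      moreover have "h i u \<in> verts H" "h i v \<in> verts H"
      proof -
        from 1(1) have "h i ` V \<subseteq> verts H" unfolding vH by blast
        with uv show "h i u \<in> verts H" "h i v \<in> verts H" by auto
      qed
      ultimately show ?thesis by blast
    next
      case 2
      have "v0 \<in> verts H" "a i \<in> verts H" "v0 \<noteq> a i"
        using a[OF 2(1)] 2(1) av0[OF 2(1)] unfolding vH by auto
      with 2 show ?thesis by blast
    qed
  qed
  have F01: "F ` verts H \<subseteq> {0, 1}"
  proof (rule image_subsetI)
    fix w assume "w \<in> verts H"
    then consider "w = v0" | i x where "i \<in> {1..t}" "x \<in> V" "w = h i x" unfolding vH by blast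
    then show "F w \<in> {0, 1}"
      by cases (use Fv0 Fh g01 in simp_all)
  qed
  have vc: "vertex_count H F b = of_bool (b = 0) + t * vertex_count G L 1" if b: "b \<in> {0, 1}" for b
  proof -
    let ?S = "\<lambda>i. h i ` {x \<in> V. g i x = b}"
    \<comment> \<open>The first set is the apex alone or empty, so that both labels are counted by
      one argument.\<close>
    have eq: "{v \<in> verts H. F v = b} = {v. v = v0 \<and> b = 0} \<union> (\<Union>i\<in>{1..t}. ?S i)"
      using Fv0 Fh by (auto simp: vH)
    have "card (?S i) = vertex_count G L 1" if "i \<in> {1..t}" for i
      using card_image[OF inj_on_subset[OF inj[OF that]], of "{x \<in> V. g i x = b}"] gv[OF b, of i]
      by (auto simp: vertex_count_def V_def)
    moreover have "card (\<Union>i\<in>{1..t}. ?S i) = (\<Sum>i\<in>{1..t}. card (?S i))"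
    proof (rule card_UN_disjoint)
      show "\<forall>i\<in>{1..t}. \<forall>j\<in>{1..t}. i \<noteq> j \<longrightarrow> ?S i \<inter> ?S j = {}"
      proof (intro ballI impI)
        fix i j assume "i \<in> {1..t}" "j \<in> {1..t}" "i \<noteq> j"
        from disj[OF this] show "?S i \<inter> ?S j = {}" by blast
      qed
    qed (use finV in auto)
    ultimately have "card (\<Union>i\<in>{1..t}. ?S i) = t * vertex_count G L 1" by simp
    moreover have "card {v. v = v0 \<and> b = 0} = of_bool (b = 0)" by simp
    moreover have "{v. v = v0 \<and> b = 0} \<inter> (\<Union>i\<in>{1..t}. ?S i) = {}" using v0 by blast
    ultimately show ?thesis unfolding vertex_count_def[of H] eq
      using finV by (subst card_Un_disjoint) auto
  qed
  have ec: "edge_count H F b = t * edge_count G L 1 + card {i \<in> {1..t}. int (i mod 2) = b}"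
    if b: "b \<in> {0, 1}" for b
  proof -
    let ?S = "\<lambda>i. (\<lambda>e. h i ` e) ` {e \<in> edges G. b \<in> edge_labels (g i) e}"
    let ?T = "(\<lambda>i. {v0, a i}) ` {i \<in> {1..t}. int (i mod 2) = b}"
    have lab: "edge_labels F (h i ` e) = edge_labels (g i) e" if "i \<in> {1..t}" "e \<in> edges G" for i e
      by (rule edge_labels_image[OF G that(2)]) (use Fh[OF that(1)] in \<open>simp add: V_def\<close>)
    have eq: "{e \<in> edges H. b \<in> edge_labels F e} = (\<Union>i\<in>{1..t}. ?S i) \<union> ?T"
      unfolding eH by (auto simp: lab Fv0 Fa)
    have "card (?S i) = edge_count G L 1" if "i \<in> {1..t}" for i
    proof -
      \<comment> \<open>Edges are sets, so injectivity is lifted from vertices to subsets of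
        \<open>V\<close>.\<close>
      have "inj_on ((`) (h i)) (Pow V)" by (rule inj_on_image_Pow[OF inj[OF that]])
      then have "inj_on ((`) (h i)) {e \<in> edges G. b \<in> edge_labels (g i) e}"
        by (rule inj_on_subset) (use eV in auto)
      from card_image[OF this] show ?thesis using ge[OF b, of i] by (simp add: edge_count_eq)
    qed
    moreover have "card (\<Union>i\<in>{1..t}. ?S i) = (\<Sum>i\<in>{1..t}. card (?S i))"
    proof (rule card_UN_disjoint)
      show "\<forall>i\<in>{1..t}. \<forall>j\<in>{1..t}. i \<noteq> j \<longrightarrow> ?S i \<inter> ?S j = {}"
      proof (intro ballI impI, rule ccontr)
        fix i j assume ij: "i \<in> {1..t}" "j \<in> {1..t}" "i \<noteq> j" and "?S i \<inter> ?S j \<noteq> {}"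
        then obtain e e' where "e \<in> edges G" "e' \<in> edges G" "h i ` e = h j ` e'" by blast
        \<comment> \<open>Edges are nonempty, so a common edge would give two disjoint copies a
          common vertex.\<close>
        then show False using edge[of e] eV[of e'] disj[OF ij] by blast
      qed
    qed (use finE in auto)
    ultimately have "card (\<Union>i\<in>{1..t}. ?S i) = t * edge_count G L 1" by simp
    moreover have "card ?T = card {i \<in> {1..t}. int (i mod 2) = b}"
    proof (rule card_image, rule inj_onI)
      fix i j assume "i \<in> {i \<in> {1..t}. int (i mod 2) = b}" "j \<in> {i \<in> {1..t}. int (i mod 2) = b}"
        and eq: "{v0, a i} = {v0, a j}"
      then have ij: "i \<in> {1..t}" "j \<in> {1..t}" by auto
      then have "a i = a j" using eq by (auto simp: doubleton_eq_iff)
      then show "i = j" using disj[OF ij] a[OF ij(1)] a[OF ij(2)] by auto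
    qed
    moreover have "(\<Union>i\<in>{1..t}. ?S i) \<inter> ?T = {}"
    proof (rule ccontr)
      assume "(\<Union>i\<in>{1..t}. ?S i) \<inter> ?T \<noteq> {}"
      then obtain i e j where "i \<in> {1..t}" "e \<in> edges G" "h i ` e = {v0, a j}" by blast
      then show False using eV[of e] v0[of i] by blast
    qed
    ultimately show ?thesis unfolding edge_count_eq[of H] eq
      using finE by (subst card_Un_disjoint) auto
  qed
  have "cordial_labeling H F"
    unfolding cordial_labeling_def using F01 card_parity_class_diff[of t] by (simp add: vc ec)
  with simple show ?thesis unfolding cordial_graph_def by blast
qed

section \<open>The balanced labeling of the Goldberg snark\<close>

text \<open>Independent of the block, so one block with its three outgoing links decides the
  balance. Four vertices get each label; five inner edges and the link \<open>(8, 8)\<close> get 0,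
  four inner edges and the other two links get 1.\<close>

definition goldberg_label :: "nat \<Rightarrow> int" where
  "goldberg_label j = of_bool (j \<in> {1, 2, 3, 6})"

text \<open>The triple \<open>(s, j, k)\<close> stands for the edge from \<open>v\<^sub>i\<^sub>,\<^sub>j\<close> to \<open>v\<^sub>i\<^sub>,\<^sub>k\<close>, if \<open>s\<close> is false, or to the
  vertex \<open>k\<close> of the next block, if \<open>s\<close> is true.\<close>

definition goldberg_edge :: "nat \<Rightarrow> nat \<times> bool \<times> nat \<times> nat \<Rightarrow> (nat \<times> nat) set" where
  "goldberg_edge n = (\<lambda>(i, s, j, k). {(i, j), (if s then i mod n + 1 else i, k)})"

text \<open>The flag keeps apart the pair \<open>(6, 7)\<close> inside a block and the same pair as
  a link.\<close>

definition goldberg_types :: "(bool \<times> nat \<times> nat) set" where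
  "goldberg_types = Pair False ` goldberg_block \<union> Pair True ` goldberg_link"

lemma edges_goldberg: "edges (goldberg n) = goldberg_edge n ` ({1..n} \<times> goldberg_types)"
proof -
  have block: "{{(i, j), (i, k)} | i j k. i \<in> {1..n} \<and> (j, k) \<in> B} =
      goldberg_edge n ` ({1..n} \<times> Pair False ` B)" for B
    by (force simp: goldberg_edge_def image_iff)
  have link: "{{(i, j), (i mod n + 1, k)} | i j k. i \<in> {1..n} \<and> (j, k) \<in> B} =
      goldberg_edge n ` ({1..n} \<times> Pair True ` B)" for B
    by (force simp: goldberg_edge_def image_iff)
  show ?thesis
    unfolding goldberg_def goldberg_types_def snd_conv block link
    by (simp only: Sigma_Un_distrib2 image_Un)
qed

lemma cyclic_succ: "i \<in> {1..n} \<Longrightarrow> i mod n + 1 = (if i = n then 1 else i + 1)" for n i :: nat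
  by auto

text \<open>Equal doubletons agree in order or swapped. Swapping two links would make some block its
  own second successor, which \<open>n \<ge> 3\<close> excludes.\<close>

lemma inj_on_goldberg_edge:
  assumes "n \<ge> 3"
  shows "inj_on (goldberg_edge n) ({1..n} \<times> goldberg_types)"
proof (rule inj_onI)
  fix x y assume xy: "x \<in> {1..n} \<times> goldberg_types" "y \<in> {1..n} \<times> goldberg_types"
    and eq: "goldberg_edge n x = goldberg_edge n y"
  obtain i s j k where x: "x = (i, s, j, k)" by (cases x)
  obtain i' s' j' k' where y: "y = (i', s', j', k')" by (cases y)
  from xy have i: "i \<in> {1..n}" "i' \<in> {1..n}"
    and ty: "(s, j, k) \<in> goldberg_types" "(s', j', k') \<in> goldberg_types"
    by (simp_all add: x y)
  have "\<not> (i = (if s' then i' mod n + 1 else i') \<and> (if s then i mod n + 1 else i) = i' \<and>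
      j = k' \<and> k = j')"
  proof
    assume swap: "i = (if s' then i' mod n + 1 else i') \<and> (if s then i mod n + 1 else i) = i' \<and>
      j = k' \<and> k = j'"
    then have "(s', k, j) \<in> goldberg_types" using ty by simp
    \<comment> \<open>Inner edges are listed with the smaller index first, so the reverse of one is
      never listed.\<close>
    moreover have "u < v" if "(False, u, v) \<in> goldberg_types" for u v
      using that by (auto simp: goldberg_types_def goldberg_block_def)
    ultimately have "s \<or> s'" using ty(1) by (metis (full_types) less_asym)
    with swap i assms show False
      unfolding cyclic_succ[OF i(1)] cyclic_succ[OF i(2)] by (auto split: if_splits)
  qed
  then have "i = i'" "j = j'" "k = k'" "(if s then i mod n + 1 else i) = (if s' then i' mod n + 1 else i')"
    using eq by (auto simp: x y goldberg_edge_def doubleton_eq_iff)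
  \<comment> \<open>The successor of \<open>i\<close> differs from \<open>i\<close>, so the second
    block index reveals the flag.\<close>
  moreover from this have "s = s'"
    using i assms unfolding cyclic_succ[OF i(1)] cyclic_succ[OF i(2)] by (auto split: if_splits)
  ultimately show "x = y" by (simp add: x y)
qed

text \<open>Only the link \<open>(8, 8)\<close> has equal indices, and its ends lie in different
  blocks once \<open>n \<ge> 2\<close>, so there are no loops.\<close>

lemma finite_simple_goldberg:
  assumes "n \<ge> 2"
  shows "finite_simple_graph (goldberg n)"
proof -
  have "\<exists>u v. goldberg_edge n (i, s, j, k) = {u, v} \<and>
      u \<in> verts (goldberg n) \<and> v \<in> verts (goldberg n) \<and> u \<noteq> v"
    if i: "i \<in> {1..n}" and ty: "(s, j, k) \<in> goldberg_types" for i s j k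
  proof (intro exI conjI)
    show "goldberg_edge n (i, s, j, k) = {(i, j), (if s then i mod n + 1 else i, k)}"
      by (simp add: goldberg_edge_def)
    have jk: "j \<in> {1..8}" "k \<in> {1..8}" "j = k \<longrightarrow> s"
      using ty by (auto simp: goldberg_types_def goldberg_block_def goldberg_link_def)
    then show "(i, j) \<in> verts (goldberg n)" using i by (simp add: goldberg_def)
    show "(if s then i mod n + 1 else i, k) \<in> verts (goldberg n)"
      using i jk unfolding cyclic_succ[OF i] by (auto simp: goldberg_def)
    show "(i, j) \<noteq> (if s then i mod n + 1 else i, k)"
      using i jk assms unfolding cyclic_succ[OF i] by auto
  qed
  then show ?thesis
    unfolding finite_simple_graph_def edges_goldberg
    by (fastforce simp: goldberg_def)
qed

lemma balanced_goldberg: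
  assumes "n \<ge> 3"
  shows "balanced_labeling (goldberg n) (goldberg_label \<circ> snd)"
proof -
  \<comment> \<open>These rules evaluate a comprehension over the explicit set of edge types element
    by element.\<close>
  have filter_insert: "{x \<in> insert a A. P x} = (if P a then insert a {x \<in> A. P x} else {x \<in> A. P x})"
    and filter_empty: "{x \<in> {}. P x} = {}" for a :: 'c and A P by auto
  have v: "vertex_count (goldberg n) (goldberg_label \<circ> snd) b = n * 4" if b: "b \<in> {0, 1}" for b
  proof -
    have "{v \<in> verts (goldberg n). (goldberg_label \<circ> snd) v = b} =
        {1..n} \<times> {j \<in> {1..8}. goldberg_label j = b}"
      by (auto simp: goldberg_def)
    moreover have "{j \<in> {1..8}. goldberg_label j = b} = (if b = 1 then {1, 2, 3, 6} else {4, 5, 7, 8})"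
      using b by (auto simp: goldberg_label_def split: if_splits)
    ultimately show ?thesis by (simp add: vertex_count_def card_cartesian_product)
  qed
  have e: "edge_count (goldberg n) (goldberg_label \<circ> snd) b = n * 6" if b: "b \<in> {0, 1}" for b
  proof -
    \<comment> \<open>The label of an edge depends only on its type, so each type in
      \<open>?D\<close> accounts for \<open>n\<close> edges.\<close>
    let ?D = "{x \<in> goldberg_types. \<bar>goldberg_label (fst (snd x)) - goldberg_label (snd (snd x))\<bar> = b}"
    have "{x \<in> {1..n} \<times> goldberg_types. b \<in> edge_labels (goldberg_label \<circ> snd) (goldberg_edge n x)}
        = {1..n} \<times> ?D"
      by (auto simp: goldberg_edge_def)
    then have "{e \<in> edges (goldberg n). b \<in> edge_labels (goldberg_label \<circ> snd) e}
        = goldberg_edge n ` ({1..n} \<times> ?D)"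
      unfolding edges_goldberg Compr_image_eq by simp
    moreover have "inj_on (goldberg_edge n) ({1..n} \<times> ?D)"
      by (rule inj_on_subset[OF inj_on_goldberg_edge[OF assms]]) auto
    ultimately have "edge_count (goldberg n) (goldberg_label \<circ> snd) b = n * card ?D"
      by (simp add: edge_count_eq card_image card_cartesian_product)
    moreover have "card ?D = 6"
      unfolding goldberg_types_def goldberg_block_def goldberg_link_def
        image_insert image_empty Un_insert_left Un_empty_left filter_insert filter_empty
      using b by (elim insertE emptyE) (simp_all add: goldberg_label_def)
    ultimately show ?thesis by simp
  qed
  show ?thesis
    unfolding balanced_labeling_def using v e by (auto simp: goldberg_label_def)
qed

theorem theorem3:
  fixes n t :: nat and H :: "'a ugraph"
  assumes "odd n" and "n \<ge> 5" and "t \<ge> 1"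
    and "open_star t (goldberg n) H"
  shows "cordial_graph H"
  using cordial_open_star[OF finite_simple_goldberg balanced_goldberg assms(4)] assms(2) by simp

end
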